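(* Suppose that: (A1) the functions $f_1,\dots,f_N:\mathbb{R}^n\to\mathbb{R}$ are bounded from below and twice continuously differentiable with $L$-Lipschitz-continuous gradients; (A2) there is a constant $G>0$ such that $E[\|g_k-\nabla f(x_k)\|^2\mid\mathcal{F}_k]\le G$ for all $k$ that are multiples of $m$. Let $\{x_k\}$ be a sequence generated by the modified SLiSeS algorithm described in the context with $m>1$ and uniform sampling. Then, with probability 1, $$\liminf_{k\to\infty}\|\nabla f(x_k)\|=0.$$
   Context: Problem: minimize $f(x)=\frac1N\sum_{i=1}^N f_i(x)$ over $x\in\mathbb{R}^n$. Let $\mathcal{N}=\{1,\dots,N\}$. For a subsample $\mathcal{N}_k\subseteq\mathcal{N}$ with $|\mathcal{N}_k|=S$, set $f_{\mathcal{N}_k}(x)=\frac1S\sum_{i\in\mathcal{N}_k}f_i(x)$ and $\nabla f_{\mathcal{N}_k}(x)=\frac1S\sum_{i\in\mathcal{N}_k}\nabla f_i(x)$. Modified SLiSeS algorithm. Input: $x_0\in\mathbb{R}^n$, $\eta\in(0,1)$, $S\in\{1,\dots,N\}$, a positive integer $m$, constants $0<\gamma_{\min}\le1\le\gamma_{\max}<\infty$, $\delta>0$ (arbitrarily small), $\tilde\gamma>0$, nonnegative numbers $t_k$ with $\sum_k t_k\le\bar t<\infty$. For $k=0,1,2,\dots$: (S1) If $k$ is a multiple of $m$, choose (randomly) $\mathcal{N}_k\subseteq\mathcal{N}$ with $|\mathcal{N}_k|=S$; otherwise $\mathcal{N}_k=\mathcal{N}_{k-1}$. (S2) $g_k=\nabla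 f_{\mathcal{N}_k}(x_k)$. (S3') If $k$ is a multiple of $m$, set $\gamma_k=\tilde\gamma/\max\{k,1\}$ and go to (S5'). Otherwise set $s_{k-1}=x_k-x_{k-1}$, $y_{k-1}=g_k-g_{k-1}$, $c_k=\|s_{k-1}\|^2/(s_{k-1}^Ty_{k-1})$ (with $c_k=1$ if this is undefined) and go to (S4'). (S4') $\gamma_k=\min\{\gamma_{\max},\max\{\gamma_{\min},c_k\}\}/k^{1+\delta}$. (S5') $d_k=-\gamma_k g_k$. If $k$ is a multiple of $m$, set $\alpha_k=1$ and go to (S7); otherwise go to (S6). (S6) Find $\alpha_k\in(0,1]$ with $f_{\mathcal{N}_k}(x_k+\alpha_kd_k)\le f_{\mathcal{N}_k}(x_k)+\eta\alpha_k d_k^T\nabla f_{\mathcal{N}_k}(x_k)+t_k$ by the procedure LSP below. (S7) $x_{k+1}=x_k+\alpha_kd_k$. LSP at iteration $k$: put $dm_k=g_k^Td_k$. Start with trial step $\alpha=1$ and repeat the following. If $f_{\mathcal{N}_k}(x_k+\alpha d_k)\le f_{\mathcal{N}_k}(x_k)+\eta\alpha\, dm_k+t_k$, stop with $\alpha_k=\alpha$. Otherwise: - if $\alpha>0.1$, compute $\tilde\alpha=\dfrac{-dm_k\,\alpha^2}{2\,(f_{\mathcal{N}_k}(x_k+\alpha d_k)-f_{\mathcal{N}_k}(x_k)-\alpha\, dm_k)}$; if $\tilde\alpha<0.1\alpha$ or $\tilde\alpha>0.9\alpha$, replace $\tilde\alpha$ by $\alpha/2$; then set $\alpha:=\tilde\alpha$;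 - if $\alpha\le0.1$, set $\alpha:=\alpha/2$. $\mathcal{F}_k$ is the $\sigma$-algebra generated by $\mathcal{N}_0,\dots,\mathcal{N}_{k-1}$. Uniform sampling: at each $k$ that is a multiple of $m$, conditionally on $\mathcal{F}_k$, $\mathcal{N}_k$ is uniformly distributed over the subsets of $\mathcal{N}$ of size $S$; in particular $E[f_{\mathcal{N}_k}(x_k)\mid\mathcal{F}_k]=f(x_k)$ and $E[g_k\mid\mathcal{F}_k]=\nabla f(x_k)$ for such $k$. *)

theory Defs
  imports "HOL-Probability.Probability"
begin

definition grad :: "('a::real_inner \<Rightarrow> real) \<Rightarrow> 'a \<Rightarrow> 'a" where
  "grad f x = (THE D. GDERIV f x :> D)"

lemma grad_eqI:
  assumes "GDERIV f x :> D"
  shows "grad f x = D"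
proof -
  have "D' = D" if "GDERIV f x :> D'" for D'
  proof -
    have "(\<lambda>h. h \<bullet> D') = (\<lambda>h. h \<bullet> D)"
      using that assms unfolding gderiv_def by (rule has_derivative_unique)
    then show ?thesis
      by (metis inner_commute vector_eq_rdot)
  qed
  with assms show ?thesis
    unfolding grad_def by blast
qed

definition twice_continuously_differentiable :: "(real^'n \<Rightarrow> real) \<Rightarrow> bool" where
  "twice_continuously_differentiable f \<longleftrightarrow>
     (\<forall>x. f differentiable (at x)) \<and>
     (\<exists>H. (\<forall>x. (grad f has_derivative (\<lambda>v. H x *v v)) (at x)) \<and> continuous_on UNIV H)"

definition avg :: "(nat \<Rightarrow> 'a \<Rightarrow> real) \<Rightarrow> nat set \<Rightarrow> 'a \<Rightarrow> real" where
  "avg f A x = (\<Sum>i\<in>A. f i x) / real (card A)"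

definition avg_grad :: "(nat \<Rightarrow> 'a::real_inner \<Rightarrow> real) \<Rightarrow> nat set \<Rightarrow> 'a \<Rightarrow> 'a" where
  "avg_grad f A x = (\<Sum>i\<in>A. grad (f i) x) /\<^sub>R real (card A)"

text \<open>In the line search, \<open>\<phi> a\<close> is the subsampled objective at \<open>x\<^sub>k + a d\<^sub>k\<close> (so that
  \<open>\<phi> 0\<close> is its value at \<open>x\<^sub>k\<close>), \<open>dm = g\<^sub>k \<bullet> d\<^sub>k\<close> and \<open>tk = t\<^sub>k\<close>.\<close>

definition lsp_accept :: "real \<Rightarrow> real \<Rightarrow> (real \<Rightarrow> real) \<Rightarrow> real \<Rightarrow> real \<Rightarrow> bool" where
  "lsp_accept \<eta> tk \<phi> dm a \<longleftrightarrow> \<phi> a \<le> \<phi> 0 + \<eta> * a * dm + tk"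

definition lsp_next :: "(real \<Rightarrow> real) \<Rightarrow> real \<Rightarrow> real \<Rightarrow> real" where
  "lsp_next \<phi> dm a =
     (if a > 1/10 then
        let b = (- dm * a\<^sup>2) / (2 * (\<phi> a - \<phi> 0 - a * dm))
        in if b < 1/10 * a \<or> b > 9/10 * a then a / 2 else b
      else a / 2)"

text \<open>\<open>lsp \<eta> tk \<phi> dm a b\<close>: started with trial step \<open>a\<close>, the line search stops and returns \<open>b\<close>.\<close>

inductive lsp :: "real \<Rightarrow> real \<Rightarrow> (real \<Rightarrow> real) \<Rightarrow> real \<Rightarrow> real \<Rightarrow> real \<Rightarrow> bool"
  for \<eta> tk \<phi> dm where
  stop: "lsp_accept \<eta> tk \<phi> dm a \<Longrightarrow> lsp \<eta> tk \<phi> dm a a"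
| continue: "\<not> lsp_accept \<eta> tk \<phi> dm a \<Longrightarrow> lsp \<eta> tk \<phi> dm (lsp_next \<phi> dm a) b \<Longrightarrow>
    lsp \<eta> tk \<phi> dm a b"

lemma lsp_next_bounds:
  assumes "0 < a" shows "0 < lsp_next \<phi> dm a" "lsp_next \<phi> dm a < a"
  using assms by (simp_all add: lsp_next_def Let_def not_less)

lemma lsp_sound:
  assumes "lsp \<eta> tk \<phi> dm a b" "0 < a" "a \<le> 1"
  shows "0 < b" "b \<le> 1" "lsp_accept \<eta> tk \<phi> dm b"
proof -
  from assms have "0 < b \<and> b \<le> 1 \<and> lsp_accept \<eta> tk \<phi> dm b"
  proof (induction rule: lsp.induct)
    case (continue a b)
    then show ?case
      using lsp_next_bounds[of a \<phi> dm] by simp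
  qed simp
  then show "0 < b" "b \<le> 1" "lsp_accept \<eta> tk \<phi> dm b" by auto
qed

lemma lsp_deterministic:
  assumes "lsp \<eta> tk \<phi> dm a b" "lsp \<eta> tk \<phi> dm a c"
  shows "b = c"
  using assms
proof (induction arbitrary: c rule: lsp.induct)
  case (stop a)
  from stop.prems show ?case
    by (cases rule: lsp.cases) (use stop.hyps in simp_all)
next
  case (continue a b)
  from continue.prems show ?case
    by (cases rule: lsp.cases) (use continue.hyps continue.IH in \<open>blast+\<close>)
qed

definition bb_coeff :: "'a::real_inner \<Rightarrow> 'a \<Rightarrow> real" where
  "bb_coeff s y = (if s \<bullet> y = 0 then 1 else (norm s)\<^sup>2 / (s \<bullet> y))"

text \<open>\<open>slises_run \<dots> NN x\<close>: with the subsamples \<open>NN 0, NN 1, \<dots>\<close> (one realisation of the random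
  choices), the modified SLiSeS algorithm produces the iterates \<open>x 0, x 1, \<dots>\<close>.
  Since \<open>0\<close> is a multiple of \<open>m\<close>,
  the indices \<open>k - 1\<close> occur only for \<open>k \<ge> 1\<close>.\<close>

definition slises_run ::
  "(nat \<Rightarrow> real^'n \<Rightarrow> real) \<Rightarrow> nat \<Rightarrow> nat \<Rightarrow> nat \<Rightarrow> real \<Rightarrow> real \<Rightarrow> real \<Rightarrow> real \<Rightarrow> real \<Rightarrow>
   (nat \<Rightarrow> real) \<Rightarrow> real^'n \<Rightarrow> (nat \<Rightarrow> nat set) \<Rightarrow> (nat \<Rightarrow> real^'n) \<Rightarrow> bool" where
  "slises_run f N S m \<eta> \<gamma>min \<gamma>max \<delta> \<gamma>til t x0 NN x \<longleftrightarrow>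
     x 0 = x0 \<and>
     (\<exists>g \<gamma> d \<alpha>. \<forall>k.
        (if m dvd k then NN k \<subseteq> {1..N} \<and> card (NN k) = S else NN k = NN (k - 1)) \<and>
        g k = avg_grad f (NN k) (x k) \<and>
        \<gamma> k = (if m dvd k then \<gamma>til / max (real k) 1
               else min \<gamma>max (max \<gamma>min (bb_coeff (x k - x (k - 1)) (g k - g (k - 1))))
                      / real k powr (1 + \<delta>)) \<and>
        d k = - (\<gamma> k *\<^sub>R g k) \<and>
        (if m dvd k then \<alpha> k = 1
         else lsp \<eta> (t k) (\<lambda>a. avg f (NN k) (x k + a *\<^sub>R d k)) (g k \<bullet> d k) 1 (\<alpha> k)) \<and>
        x (Suc k) = x k + \<alpha> k *\<^sub>R d k)"

text \<open>The \<open>\<sigma>\<close>-algebra \<open>\<F>\<^sub>k\<close> generated by \<open>NN 0, \<dots>, NN (k - 1)\<close>; it is trivial for \<open>k = 0\<close>.\<close>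

definition hist :: "'w measure \<Rightarrow> (nat \<Rightarrow> 'w \<Rightarrow> nat set) \<Rightarrow> nat \<Rightarrow> 'w measure" where
  "hist M NN k = sigma (space M) {NN j -` B \<inter> space M | j B. j < k}"

definition uniform_sampling ::
  "'w measure \<Rightarrow> nat \<Rightarrow> nat \<Rightarrow> nat \<Rightarrow> (nat \<Rightarrow> 'w \<Rightarrow> nat set) \<Rightarrow> bool" where
  "uniform_sampling M N S m NN \<longleftrightarrow>
     (\<forall>k. m dvd k \<longrightarrow> (\<forall>A. A \<subseteq> {1..N} \<and> card A = S \<longrightarrow>
        (AE \<omega> in M. real_cond_exp M (hist M NN k) (indicator {\<omega> \<in> space M. NN k \<omega> = A}) \<omega>
                      = 1 / real (N choose S))))"

end

theory Submission
  imports Defs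
begin

text \<open>The decrease comes from the cycle starts $k = jm$, where a fresh subsample gives an unbiased
  stochastic gradient step of harmonic length. The remaining steps of a cycle are a summable
  perturbation: the line search returns $\alpha_k \in (0,1]$, so their lengths are at most
  $\gamma_k = O(k^{-(1+\delta)})$. Write $F$ for the full objective,
  $a_j = |\nabla F(x_{jm})|$, $g_j$ for the subsampled gradient at $x_{jm}$ and
  $\gamma_j = \tilde\gamma / \max(jm,1)$.

  Within a cycle the subsample is fixed, so by Lipschitz continuity every gradient met in the cycle
  is bounded by a constant times $a_j + |g_j|$. Hence the whole cycle changes $F$ by at most
  $- \gamma_j \nabla F(x_{jm}) \cdot g_j + e_j (a_j^2 + |g_j|^2)$ with
  $e_j = O(j^{-2} + j^{-(1+\delta)})$; this is \<open>block_descent\<close>.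

  An iterate $x_k$ is determined by the first $k$ subsamples, of which there are finitely many, so
  all random quantities at a fixed index take finitely many values and have expectations. Uniform
  sampling makes $g_j$ unbiased given the past (\<open>expectation_uniform_choice\<close> with the double count
  \<open>sum_avg_grad_subsets\<close>), and the variance bound gives
  $E|g_j|^2 \le 2 E a_j^2 + 2G$. Taking total expectations,
  $E F(x_{(j+1)m}) \le E F(x_{jm}) - \gamma_j E a_j^2 + e_j (3 E a_j^2 + 2G).$
  Since $e_j/\gamma_j \to 0$, $\sum_j e_j < \infty$ and $F$ is bounded below, telescoping gives
  $\sum_j \gamma_j E a_j^2 < \infty$ (\<open>summable_of_descent_recursion\<close>). By monotone convergence
  $\sum_j \gamma_j a_j^2 < \infty$ almost surely, and as the harmonic weights $\gamma_j$ are not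
  summable, $a_j$ cannot stay away from $0$.\<close>

section \<open>Gradients of subsampled averages\<close>

lemma gderiv_grad_of_differentiable:
  fixes f :: "'a::euclidean_space \<Rightarrow> real"
  assumes "f differentiable (at x)"
  shows "GDERIV f x :> grad f x"
proof -
  from assms obtain D where D: "(f has_derivative D) (at x)"
    by (auto simp: differentiable_def)
  have "D h = h \<bullet> adjoint D 1" for h
    using adjoint_works[OF has_derivative_linear[OF D], of h 1] by simp
  then have "D = (\<lambda>h. h \<bullet> adjoint D 1)" by blast
  with D have "GDERIV f x :> adjoint D 1" unfolding gderiv_def by simp
  then show ?thesis using grad_eqI by metis
qed

lemma gderiv_avg:
  fixes f :: "nat \<Rightarrow> 'a::euclidean_space \<Rightarrow> real"
  assumes "\<And>i. i \<in> A \<Longrightarrow> f i differentiable (at x)"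
  shows "GDERIV (avg f A) x :> avg_grad f A x"
proof -
  have "((\<lambda>x. (\<Sum>i\<in>A. f i x) / real (card A)) has_derivative
         (\<lambda>h. (\<Sum>i\<in>A. h \<bullet> grad (f i) x) / real (card A))) (at x)"
    using gderiv_grad_of_differentiable[OF assms]
    by (auto intro!: derivative_eq_intros simp: gderiv_def divide_inverse)
  then show ?thesis
    by (simp add: gderiv_def avg_def[abs_def] avg_grad_def inner_sum_right divide_inverse mult.commute)
qed

lemma lipschitz_on_avg_grad:
  fixes f :: "nat \<Rightarrow> 'a::real_inner \<Rightarrow> real"
  assumes lip: "\<And>i. i \<in> A \<Longrightarrow> L-lipschitz_on UNIV (grad (f i))"
    and A: "finite A" "A \<noteq> {}"
  shows "L-lipschitz_on UNIV (avg_grad f A)"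
proof (rule lipschitz_onI)
  fix x y :: 'a
  have "dist (avg_grad f A x) (avg_grad f A y)
      = norm (\<Sum>i\<in>A. grad (f i) x - grad (f i) y) / real (card A)"
    by (simp add: avg_grad_def dist_norm sum_subtractf flip: scaleR_diff_right)
       (simp add: divide_inverse)
  also have "\<dots> \<le> (\<Sum>i\<in>A. L * dist x y) / real (card A)"
    by (intro divide_right_mono sum_norm_le)
       (use lipschitz_onD[OF lip] in \<open>auto simp: dist_norm\<close>)
  also have "\<dots> = L * dist x y" using A by simp
  finally show "dist (avg_grad f A x) (avg_grad f A y) \<le> L * dist x y" .
next
  show "0 \<le> L" using lip A lipschitz_on_nonneg by blast
qed

section \<open>Averaging over all subsamples of a given size\<close>

lemma card_subsets_containing:
  assumes "finite B" "i \<in> B" "0 < s"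
  shows "card {A. A \<subseteq> B \<and> card A = s \<and> i \<in> A} = (card B - 1) choose (s - 1)"
proof -
  have "bij_betw (insert i) {A. A \<subseteq> B - {i} \<and> card A = s - 1}
          {A. A \<subseteq> B \<and> card A = s \<and> i \<in> A}"
  proof (rule bij_betw_byWitness[where f' = "\<lambda>A. A - {i}"])
    show "insert i ` {A. A \<subseteq> B - {i} \<and> card A = s - 1} \<subseteq> {A. A \<subseteq> B \<and> card A = s \<and> i \<in> A}"
    proof (clarify, intro conjI)
      fix A assume A: "A \<subseteq> B - {i}" "card A = s - 1"
      then have "finite A" "i \<notin> A" using assms finite_subset by auto
      then show "card (insert i A) = s" using A assms by simp
    qed (use assms in auto)
  qed (use assms in \<open>auto simp: finite_subset\<close>)
  then have "card {A. A \<subseteq> B \<and> card A = s \<and> i \<in> A} = card {A. A \<subseteq> B - {i} \<and> card A = s - 1}"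
    by (rule bij_betw_same_card[symmetric])
  also have "\<dots> = (card B - 1) choose (s - 1)"
    using n_subsets[of "B - {i}" "s - 1"] assms by simp
  finally show ?thesis .
qed

text \<open>Each index lies in the same number of subsets of size \<open>s\<close>, so the sum over all subsets weighs all
  gradients equally. This is what makes a uniformly drawn subsample gradient unbiased.\<close>

lemma sum_avg_grad_subsets:
  assumes B: "finite B" and s: "0 < s" "s \<le> card B"
  shows "(\<Sum>A | A \<subseteq> B \<and> card A = s. avg_grad f A x) = real (card B choose s) *\<^sub>R avg_grad f B x"
proof -
  let ?P = "{A. A \<subseteq> B \<and> card A = s}"
  have fin: "finite ?P" using B by simp
  have "(\<Sum>A\<in>?P. avg_grad f A x) = (\<Sum>A\<in>?P. \<Sum>i\<in>A. grad (f i) x) /\<^sub>R real s"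
    unfolding scaleR_sum_right by (intro sum.cong) (auto simp: avg_grad_def scaleR_sum_right)
  also have "(\<Sum>A\<in>?P. \<Sum>i\<in>A. grad (f i) x) = (\<Sum>A\<in>?P. \<Sum>i | i \<in> B \<and> i \<in> A. grad (f i) x)"
    by (intro sum.cong) (auto intro!: sum.cong)
  also have "\<dots> = (\<Sum>i\<in>B. \<Sum>A | A \<in> ?P \<and> i \<in> A. grad (f i) x)"
    using fin B by (rule sum.swap_restrict)
  also have "\<dots> = (\<Sum>i\<in>B. real ((card B - 1) choose (s - 1)) *\<^sub>R grad (f i) x)"
  proof (intro sum.cong refl)
    fix i assume "i \<in> B"
    then have "card {A. A \<in> ?P \<and> i \<in> A} = (card B - 1) choose (s - 1)"
      using card_subsets_containing[of B i s] B s by (simp add: conj_assoc)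
    then show "(\<Sum>A | A \<in> ?P \<and> i \<in> A. grad (f i) x)
        = real ((card B - 1) choose (s - 1)) *\<^sub>R grad (f i) x"
      by (simp add: sum_constant_scaleR)
  qed
  also have "\<dots> = real ((card B - 1) choose (s - 1)) *\<^sub>R (\<Sum>i\<in>B. grad (f i) x)"
    by (simp add: scaleR_sum_right)
  also have "\<dots> /\<^sub>R real s = (real (card B choose s) / real (card B)) *\<^sub>R (\<Sum>i\<in>B. grad (f i) x)"
  proof -
    have "s * (card B choose s) = card B * ((card B - 1) choose (s - 1))"
      using binomial_absorption[of "s - 1" "card B"] s by simp
    then have "real s * real (card B choose s) = real (card B) * real ((card B - 1) choose (s - 1))"
      by (metis of_nat_mult)
    then have "inverse (real s) * real ((card B - 1) choose (s - 1)) = real (card B choose s) / real (card B)"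
      using s by (simp add: field_simps)
    then show ?thesis by simp
  qed
  finally show ?thesis by (simp add: avg_grad_def divide_inverse)
qed

section \<open>Descent over one cycle\<close>

text \<open>The mean value theorem at an intermediate point suffices: it yields \<open>L\<close> in place of the sharp
  constant \<open>L/2\<close>, and constants are irrelevant for the convergence argument.\<close>

lemma gderiv_descent:
  fixes F :: "'a::real_inner \<Rightarrow> real"
  assumes der: "\<And>x. GDERIV F x :> q x" and lip: "L-lipschitz_on UNIV q"
  shows "F (x + d) \<le> F x + q x \<bullet> d + L * (norm d)\<^sup>2"
proof -
  have "((\<lambda>s. F (x + s *\<^sub>R d)) has_real_derivative d \<bullet> q (x + s *\<^sub>R d)) (at s)" for s
  proof -
    have "((\<lambda>s. x + s *\<^sub>R d) has_derivative (\<lambda>h. h *\<^sub>R d)) (at s)"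
      by (auto intro!: derivative_eq_intros)
    then have "((\<lambda>s. F (x + s *\<^sub>R d)) has_derivative (\<lambda>h. (h *\<^sub>R d) \<bullet> q (x + s *\<^sub>R d))) (at s)"
      using der[of "x + s *\<^sub>R d"] unfolding gderiv_def by (rule has_derivative_compose)
    then show ?thesis
      by (simp add: has_field_derivative_def mult.commute[of _ "d \<bullet> _"])
  qed
  then obtain s where s: "0 < s" "s < 1" "F (x + 1 *\<^sub>R d) - F (x + 0 *\<^sub>R d) = (1 - 0) * (d \<bullet> q (x + s *\<^sub>R d))"
    using MVT2[of 0 1 "\<lambda>s. F (x + s *\<^sub>R d)" "\<lambda>s. d \<bullet> q (x + s *\<^sub>R d)"] by auto
  have "d \<bullet> q (x + s *\<^sub>R d) = q x \<bullet> d + d \<bullet> (q (x + s *\<^sub>R d) - q x)"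
    by (simp add: inner_diff_right inner_commute)
  also have "d \<bullet> (q (x + s *\<^sub>R d) - q x) \<le> norm d * norm (q (x + s *\<^sub>R d) - q x)"
    by (rule norm_cauchy_schwarz)
  also have "\<dots> \<le> norm d * (L * norm d)"
  proof (rule mult_left_mono)
    have "norm (q (x + s *\<^sub>R d) - q x) \<le> L * norm (s *\<^sub>R d)"
      using lipschitz_onD[OF lip, of "x + s *\<^sub>R d" x] by (simp add: dist_norm)
    also have "\<dots> \<le> L * norm d"
      using s lipschitz_on_nonneg[OF lip] by (intro mult_left_mono) (simp_all add: mult_left_le_one_le)
    finally show "norm (q (x + s *\<^sub>R d) - q x) \<le> L * norm d" .
  qed simp
  finally show ?thesis using s by (simp add: power2_eq_square mult_ac)
qed

text \<open>One cycle in isolation: \<open>z 0, ..., z m\<close> are its iterates, \<open>q\<close> is the gradient of the full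
  objective, \<open>h\<close> that of the subsampled one, and \<open>\<beta> i\<close> the effective step length. Gradients along the
  cycle grow at most geometrically, by a factor \<open>1 + L\<Gamma>\<close> per step, so all of them are controlled by
  the two gradients at \<open>z 0\<close>. The first step keeps its signed inner product, because that term becomes
  a decrease in expectation; the later steps are only bounded in absolute value, which is affordable
  since their lengths are at most the small number \<open>c\<close>.\<close>

lemma block_descent:
  fixes F :: "'a::real_inner \<Rightarrow> real" and z :: "nat \<Rightarrow> 'a"
  assumes der: "\<And>x. GDERIV F x :> q x" and qlip: "L-lipschitz_on UNIV q"
    and hlip: "L-lipschitz_on UNIV h"
    and step: "\<And>i. i < m \<Longrightarrow> z (Suc i) = z i - \<beta> i *\<^sub>R h (z i)"
    and beta: "\<And>i. i < m \<Longrightarrow> 0 \<le> \<beta> i" "\<And>i. i < m \<Longrightarrow> \<beta> i \<le> \<Gamma>"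
    and small: "\<And>i. 0 < i \<Longrightarrow> i < m \<Longrightarrow> \<beta> i \<le> c"
    and c: "0 \<le> c" and m: "0 < m"
    and C_def: "C = (1 + L * \<Gamma>) ^ m" and K_def: "K = C + L * (real m + 1) * \<Gamma> * C\<^sup>2"
  shows "F (z m) \<le> F (z 0) - \<beta> 0 * (q (z 0) \<bullet> h (z 0))
           + (L * (\<beta> 0)\<^sup>2 + real m * c * K) * ((norm (q (z 0)))\<^sup>2 + (norm (h (z 0)))\<^sup>2)"
proof -
  define a where "a = norm (q (z 0))"
  define r where "r = norm (h (z 0))"
  have ar: "0 \<le> a" "0 \<le> r" by (auto simp: a_def r_def)
  have L: "0 \<le> L" by (rule lipschitz_on_nonneg[OF qlip])
  have \<Gamma>: "0 \<le> \<Gamma>" using beta[OF m] by linarith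
  have C1: "1 \<le> C" using L \<Gamma> by (simp add: C_def one_le_power)
  have pow: "norm (h (z i)) \<le> (1 + L * \<Gamma>) ^ i * r" if "i \<le> m" for i
    using that
  proof (induction i)
    case 0 then show ?case by (simp add: r_def)
  next
    case (Suc i)
    then have i: "i < m" by simp
    have "norm (h (z (Suc i))) \<le> norm (h (z i)) + dist (h (z (Suc i))) (h (z i))"
      by (metis dist_norm norm_triangle_sub)
    also have "dist (h (z (Suc i))) (h (z i)) \<le> L * dist (z (Suc i)) (z i)"
      using lipschitz_onD[OF hlip] by simp
    also have "dist (z (Suc i)) (z i) = \<beta> i * norm (h (z i))"
      using step[OF i] beta(1)[OF i] by (simp add: dist_norm)
    also have "L * (\<beta> i * norm (h (z i))) \<le> L * (\<Gamma> * norm (h (z i)))"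
      using L beta(2)[OF i] by (intro mult_left_mono mult_right_mono) auto
    also have "norm (h (z i)) + L * (\<Gamma> * norm (h (z i))) = (1 + L * \<Gamma>) * norm (h (z i))"
      by (simp add: algebra_simps)
    also have "\<dots> \<le> (1 + L * \<Gamma>) * ((1 + L * \<Gamma>) ^ i * r)"
      using Suc L \<Gamma> by (intro mult_left_mono) auto
    finally show ?case by (simp add: mult.assoc)
  qed
  have h_le: "norm (h (z i)) \<le> C * r" if "i \<le> m" for i
  proof -
    have "(1 + L * \<Gamma>) ^ i * r \<le> C * r"
      unfolding C_def using that L \<Gamma> ar by (intro mult_right_mono power_increasing) auto
    with pow[OF that] show ?thesis by linarith
  qed
  have drift: "dist (z i) (z 0) \<le> real i * (\<Gamma> * (C * r))" if "i \<le> m" for i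
    using that
  proof (induction i)
    case (Suc i)
    then have i: "i < m" by simp
    have "dist (z (Suc i)) (z 0) \<le> dist (z (Suc i)) (z i) + dist (z i) (z 0)"
      by (rule dist_triangle)
    also have "dist (z (Suc i)) (z i) = \<beta> i * norm (h (z i))"
      using step[OF i] beta(1)[OF i] by (simp add: dist_norm)
    also have "\<dots> \<le> \<Gamma> * (C * r)"
      using beta[OF i] h_le[of i] i \<Gamma> by (intro mult_mono) auto
    finally show ?case using Suc by (simp add: algebra_simps)
  qed simp
  have q_le: "norm (q (z i)) \<le> a + L * (real m * (\<Gamma> * (C * r)))" if "i \<le> m" for i
  proof -
    have "norm (q (z i)) \<le> a + dist (q (z i)) (q (z 0))"
      unfolding a_def by (metis dist_norm norm_triangle_sub)
    also have "dist (q (z i)) (q (z 0)) \<le> L * dist (z i) (z 0)"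
      using lipschitz_onD[OF qlip] by simp
    also have "\<dots> \<le> L * (real m * (\<Gamma> * (C * r)))"
    proof (rule mult_left_mono[OF _ L])
      have "real i * (\<Gamma> * (C * r)) \<le> real m * (\<Gamma> * (C * r))"
        using that \<Gamma> C1 ar by (intro mult_right_mono) auto
      then show "dist (z i) (z 0) \<le> real m * (\<Gamma> * (C * r))" using drift[OF that] by linarith
    qed
    finally show ?thesis by simp
  qed
  have am_gm: "a * r \<le> a\<^sup>2 + r\<^sup>2"
    using sum_squares_bound[of a r] ar mult_nonneg_nonneg[of a r] by linarith
  have first: "F (z (Suc 0)) \<le> F (z 0) - \<beta> 0 * (q (z 0) \<bullet> h (z 0)) + L * (\<beta> 0)\<^sup>2 * (a\<^sup>2 + r\<^sup>2)"
  proof -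
    have "F (z (Suc 0)) \<le> F (z 0) - \<beta> 0 * (q (z 0) \<bullet> h (z 0)) + L * ((\<beta> 0)\<^sup>2 * r\<^sup>2)"
      using gderiv_descent[OF der qlip, of "z 0" "- (\<beta> 0 *\<^sub>R h (z 0))"] step[OF m]
      by (simp add: r_def power_mult_distrib)
    also have "L * ((\<beta> 0)\<^sup>2 * r\<^sup>2) \<le> L * ((\<beta> 0)\<^sup>2 * (a\<^sup>2 + r\<^sup>2))"
      using L by (intro mult_left_mono) auto
    finally show ?thesis by (simp add: mult.assoc)
  qed
  have later: "F (z (Suc i)) \<le> F (z i) + c * (K * (a\<^sup>2 + r\<^sup>2))" if i: "0 < i" "i < m" for i
  proof -
    let ?n = "norm (h (z i))"
    have b: "0 \<le> \<beta> i" "\<beta> i \<le> \<Gamma>" "\<beta> i \<le> c" using beta small i by auto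
    have n: "?n \<le> C * r" "norm (q (z i)) \<le> a + L * (real m * (\<Gamma> * (C * r)))"
      using h_le q_le i by auto
    have Cr: "0 \<le> C * r" using C1 ar by simp
    have "F (z (Suc i)) \<le> F (z i) - \<beta> i * (q (z i) \<bullet> h (z i)) + L * (\<beta> i * ?n)\<^sup>2"
      using gderiv_descent[OF der qlip, of "z i" "- (\<beta> i *\<^sub>R h (z i))"] step[OF i(2)] b
      by simp
    moreover have "- (q (z i) \<bullet> h (z i)) \<le> (a + L * (real m * (\<Gamma> * (C * r)))) * (C * r)"
    proof -
      have "- (q (z i) \<bullet> h (z i)) \<le> norm (q (z i)) * ?n"
        using Cauchy_Schwarz_ineq2[of "q (z i)" "h (z i)"] by linarith
      also have "\<dots> \<le> (a + L * (real m * (\<Gamma> * (C * r)))) * (C * r)"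
        using n ar L \<Gamma> Cr by (intro mult_mono) auto
      finally show ?thesis .
    qed
    then have "\<beta> i * - (q (z i) \<bullet> h (z i)) \<le> \<beta> i * ((a + L * (real m * (\<Gamma> * (C * r)))) * (C * r))"
      using b by (intro mult_left_mono) auto
    moreover have "L * (\<beta> i * ?n)\<^sup>2 \<le> \<beta> i * (L * (\<Gamma> * (C * r)\<^sup>2))"
    proof -
      have "(\<beta> i * ?n)\<^sup>2 = \<beta> i * (\<beta> i * ?n\<^sup>2)" by (simp add: power2_eq_square)
      also have "\<dots> \<le> \<beta> i * (\<Gamma> * (C * r)\<^sup>2)"
        using b n \<Gamma> by (intro mult_left_mono mult_mono power_mono) auto
      finally show ?thesis using L by (simp add: mult_left_mono mult.left_commute)
    qed
    ultimately have "F (z (Suc i)) \<le> F (z i)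
        + \<beta> i * ((a + L * (real m * (\<Gamma> * (C * r)))) * (C * r) + L * (\<Gamma> * (C * r)\<^sup>2))"
      by (simp add: distrib_left)
    also have "(a + L * (real m * (\<Gamma> * (C * r)))) * (C * r) + L * (\<Gamma> * (C * r)\<^sup>2)
        = C * (a * r) + L * (real m + 1) * \<Gamma> * C\<^sup>2 * r\<^sup>2"
      by (simp add: algebra_simps power2_eq_square)
    also have "\<beta> i * \<dots> \<le> c * (K * (a\<^sup>2 + r\<^sup>2))"
    proof (rule mult_mono)
      have "C * (a * r) \<le> C * (a\<^sup>2 + r\<^sup>2)" using C1 am_gm by (intro mult_left_mono) auto
      moreover have "L * (real m + 1) * \<Gamma> * C\<^sup>2 * r\<^sup>2 \<le> L * (real m + 1) * \<Gamma> * C\<^sup>2 * (a\<^sup>2 + r\<^sup>2)"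
        using L \<Gamma> by (intro mult_left_mono) auto
      ultimately show "C * (a * r) + L * (real m + 1) * \<Gamma> * C\<^sup>2 * r\<^sup>2 \<le> K * (a\<^sup>2 + r\<^sup>2)"
        by (simp add: K_def distrib_right)
    qed (use b c C1 ar L \<Gamma> in auto)
    finally show ?thesis by simp
  qed
  have K0: "0 \<le> K" using C1 L \<Gamma> by (simp add: K_def)
  have tot: "F (z (Suc i)) \<le> F (z (Suc 0)) + real i * (c * (K * (a\<^sup>2 + r\<^sup>2)))" if "Suc i \<le> m" for i
    using that
  proof (induction i)
    case (Suc i)
    then show ?case using later[of "Suc i"] by (simp add: algebra_simps)
  qed simp
  have "F (z m) \<le> F (z (Suc 0)) + real (m - 1) * (c * (K * (a\<^sup>2 + r\<^sup>2)))"
    using tot[of "m - 1"] m by simp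
  also have "real (m - 1) * (c * (K * (a\<^sup>2 + r\<^sup>2))) \<le> real m * (c * (K * (a\<^sup>2 + r\<^sup>2)))"
    using c K0 by (intro mult_right_mono) auto
  finally show ?thesis using first unfolding a_def[symmetric] r_def[symmetric]
    by (simp add: algebra_simps)
qed

section \<open>Summability arguments\<close>

text \<open>As soon as \<open>e j \<le> \<gamma> j / 6\<close>, the error term \<open>3 * e j * w j\<close> absorbs at most half of the decrease
  \<open>\<gamma> j * w j\<close>; from there on the recursion telescopes.\<close>

lemma summable_of_descent_recursion:
  fixes v w \<gamma> e :: "nat \<Rightarrow> real"
  assumes rec: "\<And>j. v (Suc j) \<le> v j - \<gamma> j * w j + e j * (3 * w j + b)"
    and w: "\<And>j. 0 \<le> w j" and \<gamma>: "\<And>j. 0 < \<gamma> j"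
    and e: "\<And>j. 0 \<le> e j" "summable e" "(\<lambda>j. e j / \<gamma> j) \<longlonglongrightarrow> 0"
    and b: "0 \<le> b" and low: "\<And>j. B \<le> v j"
  shows "summable (\<lambda>j. \<gamma> j * w j)"
proof -
  have "\<forall>\<^sub>F j in sequentially. e j / \<gamma> j < 1/6"
    using e(3) by (rule order_tendstoD) simp
  then obtain J where J: "\<And>j. J \<le> j \<Longrightarrow> e j / \<gamma> j < 1/6"
    by (auto simp: eventually_sequentially)
  have half: "\<gamma> j * w j \<le> 2 * (v j - v (Suc j) + b * e j)" if "J \<le> j" for j
  proof -
    have "6 * e j \<le> \<gamma> j" using J[OF that] \<gamma>[of j] by (simp add: field_simps)
    then have "6 * e j * w j \<le> \<gamma> j * w j" using w by (intro mult_right_mono) auto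
    then show ?thesis using rec[of j] by (simp add: algebra_simps)
  qed
  have "summable (\<lambda>j. \<gamma> (j + J) * w (j + J))"
  proof (rule bounded_imp_summable)
    show "0 \<le> \<gamma> (j + J) * w (j + J)" for j using w \<gamma> by (simp add: less_imp_le)
    have sJ: "summable (\<lambda>j. e (j + J))" using e(2) by (simp add: summable_iff_shift)
    fix n
    have "(\<Sum>j\<le>n. \<gamma> (j + J) * w (j + J))
        \<le> (\<Sum>j\<le>n. 2 * (v (j + J) - v (Suc j + J) + b * e (j + J)))"
      using half by (intro sum_mono) simp
    also have "\<dots> = 2 * ((\<Sum>j\<le>n. v (j + J) - v (Suc j + J)) + b * (\<Sum>j\<le>n. e (j + J)))"
      by (simp add: sum.distrib sum_distrib_left distrib_left right_diff_distrib mult.left_commute)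
    also have "(\<Sum>j\<le>n. v (j + J) - v (Suc j + J)) = v J - v (Suc n + J)"
      by (subst sum_telescope) simp
    also have "2 * (v J - v (Suc n + J) + b * (\<Sum>j\<le>n. e (j + J)))
        \<le> 2 * (v J - B + b * (\<Sum>j. e (j + J)))"
      using low sum_le_suminf[OF sJ, of "{..n}"] e(1) b
      by (intro mult_left_mono add_mono diff_mono) auto
    finally show "(\<Sum>j\<le>n. \<gamma> (j + J) * w (j + J)) \<le> 2 * (v J - B + b * (\<Sum>j. e (j + J)))" .
  qed
  then show ?thesis by (rule summable_iff_shift[of "\<lambda>j. \<gamma> j * w j" J, THEN iffD1])
qed

text \<open>If \<open>a\<close> stayed above some \<open>\<epsilon> > 0\<close> eventually, comparison would make \<open>\<gamma>\<close> summable. Control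
  along the multiples of \<open>m\<close> is enough, since a lower limit only needs a subsequence.\<close>

lemma liminf_zero_of_weighted_summable:
  fixes a :: "nat \<Rightarrow> real" and \<gamma> :: "nat \<Rightarrow> real"
  assumes a: "\<And>k. 0 \<le> a k" and m: "0 < m"
    and \<gamma>: "\<And>j. 0 \<le> \<gamma> j" "\<not> summable \<gamma>"
    and sum: "summable (\<lambda>j. \<gamma> j * (a (j * m))\<^sup>2)"
  shows "liminf (\<lambda>k. ereal (a k)) = 0"
proof (rule antisym)
  show "0 \<le> liminf (\<lambda>k. ereal (a k))"
    using a by (intro Liminf_bounded) auto
  show "liminf (\<lambda>k. ereal (a k)) \<le> 0"
  proof (rule ccontr)
    assume "\<not> liminf (\<lambda>k. ereal (a k)) \<le> 0"
    then obtain \<epsilon> where \<epsilon>: "0 < ereal \<epsilon>" "ereal \<epsilon> < liminf (\<lambda>k. ereal (a k))"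
      using ereal_dense2[of 0 "liminf (\<lambda>k. ereal (a k))"] by (auto simp: not_le)
    from less_LiminfD[OF \<epsilon>(2)] obtain n where n: "\<And>k. n \<le> k \<Longrightarrow> \<epsilon> < a k"
      by (auto simp: eventually_sequentially)
    have "\<forall>\<^sub>F j in sequentially. norm (\<gamma> j * \<epsilon>\<^sup>2) \<le> \<gamma> j * (a (j * m))\<^sup>2"
    proof (rule eventually_sequentiallyI)
      fix j assume "n \<le> j"
      then have "n \<le> j * m" using m by (metis le_trans mult.right_neutral mult_le_mono2 Suc_leI One_nat_def)
      then have "\<epsilon>\<^sup>2 \<le> (a (j * m))\<^sup>2" using n[of "j * m"] \<epsilon>(1) by (intro power_mono) auto
      then show "norm (\<gamma> j * \<epsilon>\<^sup>2) \<le> \<gamma> j * (a (j * m))\<^sup>2"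
        using \<gamma>(1) by (simp add: abs_mult mult_left_mono)
    qed
    then have "summable (\<lambda>j. \<gamma> j * \<epsilon>\<^sup>2)"
      by (rule summable_comparison_test_ev) (rule sum)
    then have "summable \<gamma>"
      using summable_mult2[of "\<lambda>j. \<gamma> j * \<epsilon>\<^sup>2" "inverse (\<epsilon>\<^sup>2)"] \<epsilon>(1) by (simp add: mult.assoc)
    with \<gamma>(2) show False ..
  qed
qed

text \<open>By monotone convergence the integral of the pointwise sum is the sum of the integrals, and a
  nonnegative function with finite integral is finite almost everywhere.\<close>

lemma AE_summable_of_summable_integrals:
  fixes X :: "nat \<Rightarrow> 'w \<Rightarrow> real"
  assumes int: "\<And>j. integrable M (X j)" and nonneg: "\<And>j \<omega>. 0 \<le> X j \<omega>"
    and sum: "summable (\<lambda>j. integral\<^sup>L M (X j))"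
  shows "AE \<omega> in M. summable (\<lambda>j. X j \<omega>)"
proof -
  have "(\<integral>\<^sup>+\<omega>. (\<Sum>j. ennreal (X j \<omega>)) \<partial>M) = (\<Sum>j. \<integral>\<^sup>+\<omega>. ennreal (X j \<omega>) \<partial>M)"
    using int by (intro nn_integral_suminf) auto
  also have "\<dots> = (\<Sum>j. ennreal (integral\<^sup>L M (X j)))"
    using int nonneg by (simp add: nn_integral_eq_integral)
  also have "\<dots> = ennreal (\<Sum>j. integral\<^sup>L M (X j))"
    using sum nonneg by (intro suminf_ennreal2) (auto intro: integral_nonneg)
  finally have "(\<integral>\<^sup>+\<omega>. (\<Sum>j. ennreal (X j \<omega>)) \<partial>M) \<noteq> \<infinity>" by simp
  then have "AE \<omega> in M. (\<Sum>j. ennreal (X j \<omega>)) \<noteq> \<infinity>"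
    using int by (intro nn_integral_PInf_AE) auto
  then show ?thesis
    by eventually_elim (use nonneg in \<open>auto intro!: summable_suminf_not_top simp: top_ennreal_def\<close>)
qed

section \<open>Step lengths at the cycle starts\<close>

text \<open>All step bounds in cycle \<open>j\<close> are multiples of negative powers of \<open>max (real (j * m)) 1\<close>, where the
  maximum avoids a division by zero at \<open>j = 0\<close>. Comparison with powers of \<open>j\<close> settles their
  convergence.\<close>

lemma inverse_powr_multiple_le:
  assumes "0 < m" "0 < p" "1 \<le> j"
  shows "inverse (max (real (j * m)) 1 powr p) \<le> real j powr - p"
proof -
  have "real j * 1 \<le> real j * real m" using assms by (intro mult_left_mono) auto
  then have "real j \<le> max (real (j * m)) 1" by simp
  then have "real j powr p \<le> max (real (j * m)) 1 powr p"
    using assms by (intro powr_mono2) auto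
  then show ?thesis unfolding powr_minus using assms by (intro le_imp_inverse_le) auto
qed

lemma tendsto_powr_neg_multiples:
  assumes "0 < m" "0 < p"
  shows "(\<lambda>j. inverse (max (real (j * m)) 1 powr p)) \<longlonglongrightarrow> 0"
proof (rule tendsto_sandwich[of "\<lambda>_. 0" _ _ "\<lambda>j. real j powr - p"])
  show "\<forall>\<^sub>F j in sequentially. inverse (max (real (j * m)) 1 powr p) \<le> real j powr - p"
    using inverse_powr_multiple_le[OF assms] by (rule eventually_sequentiallyI)
  show "(\<lambda>j. real j powr - p) \<longlonglongrightarrow> 0"
    using assms by (intro tendsto_neg_powr filterlim_real_sequentially) auto
qed auto

lemma summable_powr_neg_multiples:
  assumes "0 < m" "1 < p"
  shows "summable (\<lambda>j. inverse (max (real (j * m)) 1 powr p))"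
proof (rule summable_comparison_test_ev)
  show "summable (\<lambda>j. real j powr - p)" using assms by (simp add: summable_real_powr_iff)
  show "\<forall>\<^sub>F j in sequentially. norm (inverse (max (real (j * m)) 1 powr p)) \<le> real j powr - p"
    using inverse_powr_multiple_le[of m p] assms by (intro eventually_sequentiallyI[of 1]) simp
qed

lemma not_summable_harmonic_multiples:
  assumes "0 < m" "0 < (c::real)"
  shows "\<not> summable (\<lambda>j. c / max (real (j * m)) 1)"
proof
  assume "summable (\<lambda>j. c / max (real (j * m)) 1)"
  then have "summable (\<lambda>j. (real m / c) * (c / max (real (Suc j * m)) 1))"
    by (intro summable_mult) (rule summable_Suc_iff[THEN iffD2])
  moreover have "(real m / c) * (c / max (real (Suc j * m)) 1) = inverse (real (Suc j))" for j
  proof -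
    have "1 \<le> Suc j * m" using assms by simp
    then have "max (real (Suc j * m)) 1 = real (Suc j) * real m"
      by (metis max.absorb1 of_nat_mult of_nat_1 of_nat_le_iff)
    then show ?thesis using assms by (simp add: field_simps)
  qed
  ultimately have "summable (\<lambda>j. inverse (real (Suc j)))" by (simp only:)
  then have "summable (\<lambda>j. inverse (real j))" by (rule summable_Suc_iff[THEN iffD1])
  with not_summable_harmonic[where 'a = real] show False by simp
qed

section \<open>Pathwise properties of the algorithm\<close>

lemma slises_runE:
  assumes run: "slises_run f N S m \<eta> \<gamma>min \<gamma>max \<delta> \<gamma>til t x0 NN x"
  obtains g \<gamma> d \<alpha> where
    "\<And>k. if m dvd k then NN k \<subseteq> {1..N} \<and> card (NN k) = S else NN k = NN (k - 1)"
    "\<And>k. g k = avg_grad f (NN k) (x k)"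
    "\<And>k. \<gamma> k = (if m dvd k then \<gamma>til / max (real k) 1
             else min \<gamma>max (max \<gamma>min (bb_coeff (x k - x (k - 1)) (g k - g (k - 1))))
                    / real k powr (1 + \<delta>))"
    "\<And>k. d k = - (\<gamma> k *\<^sub>R g k)"
    "\<And>k. if m dvd k then \<alpha> k = 1
       else lsp \<eta> (t k) (\<lambda>a. avg f (NN k) (x k + a *\<^sub>R d k)) (g k \<bullet> d k) 1 (\<alpha> k)"
    "\<And>k. x (Suc k) = x k + \<alpha> k *\<^sub>R d k"
proof -
  from run obtain g \<gamma> d \<alpha> where R: "\<forall>k.
        (if m dvd k then NN k \<subseteq> {1..N} \<and> card (NN k) = S else NN k = NN (k - 1)) \<and>
        g k = avg_grad f (NN k) (x k) \<and>
        \<gamma> k = (if m dvd k then \<gamma>til / max (real k) 1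
               else min \<gamma>max (max \<gamma>min (bb_coeff (x k - x (k - 1)) (g k - g (k - 1))))
                      / real k powr (1 + \<delta>)) \<and>
        d k = - (\<gamma> k *\<^sub>R g k) \<and>
        (if m dvd k then \<alpha> k = 1
         else lsp \<eta> (t k) (\<lambda>a. avg f (NN k) (x k + a *\<^sub>R d k)) (g k \<bullet> d k) 1 (\<alpha> k)) \<and>
        x (Suc k) = x k + \<alpha> k *\<^sub>R d k"
    unfolding slises_run_def by (elim conjE exE)
  show thesis
  proof (rule that[of g \<gamma> d \<alpha>])
    fix k
    note R[rule_format, of k]
    note * = this this[THEN conjunct2] this[THEN conjunct2, THEN conjunct2]
      this[THEN conjunct2, THEN conjunct2, THEN conjunct2]
      this[THEN conjunct2, THEN conjunct2, THEN conjunct2, THEN conjunct2]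
    show "if m dvd k then NN k \<subseteq> {1..N} \<and> card (NN k) = S else NN k = NN (k - 1)" by (rule *(1)[THEN conjunct1])
    show "g k = avg_grad f (NN k) (x k)" by (rule *(2)[THEN conjunct1])
    show "\<gamma> k = (if m dvd k then \<gamma>til / max (real k) 1
             else min \<gamma>max (max \<gamma>min (bb_coeff (x k - x (k - 1)) (g k - g (k - 1))))
                    / real k powr (1 + \<delta>))" by (rule *(3)[THEN conjunct1])
    show "d k = - (\<gamma> k *\<^sub>R g k)" by (rule *(4)[THEN conjunct1])
    show "if m dvd k then \<alpha> k = 1
       else lsp \<eta> (t k) (\<lambda>a. avg f (NN k) (x k + a *\<^sub>R d k)) (g k \<bullet> d k) 1 (\<alpha> k)"
      by (rule *(5)[THEN conjunct1])
    show "x (Suc k) = x k + \<alpha> k *\<^sub>R d k" by (rule *(5)[THEN conjunct2])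
  qed
qed

lemma slises_run_subsample:
  assumes run: "slises_run f N S m \<eta> \<gamma>min \<gamma>max \<delta> \<gamma>til t x0 NN x"
  shows "NN k \<subseteq> {1..N} \<and> card (NN k) = S"
proof (induction k)
  case 0
  from run obtain "if m dvd 0 then NN 0 \<subseteq> {1..N} \<and> card (NN 0) = S else NN 0 = NN (0 - 1)"
    by (rule slises_runE) blast
  then show ?case by simp
next
  case (Suc k)
  from run obtain "if m dvd Suc k then NN (Suc k) \<subseteq> {1..N} \<and> card (NN (Suc k)) = S
      else NN (Suc k) = NN (Suc k - 1)"
    by (rule slises_runE) blast
  with Suc show ?case by (auto split: if_splits)
qed

text \<open>Apart from the subsamples nothing is random: the line search returns at most one step, and the
  spectral coefficient looks back a single iteration. This makes \<open>x k\<close> measurable with respect to the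
  history before \<open>k\<close>.\<close>

lemma slises_run_deterministic:
  assumes run: "slises_run f N S m \<eta> \<gamma>min \<gamma>max \<delta> \<gamma>til t x0 NN x"
    and run': "slises_run f N S m \<eta> \<gamma>min \<gamma>max \<delta> \<gamma>til t x0 NN' x'"
    and eq: "\<And>j. j < k \<Longrightarrow> NN j = NN' j"
  shows "x k = x' k"
  using eq
proof (induction k rule: less_induct)
  case (less k)
  show ?case
  proof (cases k)
    case 0
    then show ?thesis using run run' by (simp add: slises_run_def)
  next
    case (Suc i)
    from run obtain g \<gamma> d \<alpha> where R:
    "\<And>k. if m dvd k then NN k \<subseteq> {1..N} \<and> card (NN k) = S else NN k = NN (k - 1)"
    "\<And>k. g k = avg_grad f (NN k) (x k)"
    "\<And>k. \<gamma> k = (if m dvd k then \<gamma>til / max (real k) 1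
             else min \<gamma>max (max \<gamma>min (bb_coeff (x k - x (k - 1)) (g k - g (k - 1))))
                    / real k powr (1 + \<delta>))"
    "\<And>k. d k = - (\<gamma> k *\<^sub>R g k)"
    "\<And>k. if m dvd k then \<alpha> k = 1
       else lsp \<eta> (t k) (\<lambda>a. avg f (NN k) (x k + a *\<^sub>R d k)) (g k \<bullet> d k) 1 (\<alpha> k)"
    "\<And>k. x (Suc k) = x k + \<alpha> k *\<^sub>R d k"
      by (rule slises_runE) blast
    from run' obtain g' \<gamma>' d' \<alpha>' where R':
    "\<And>k. if m dvd k then NN' k \<subseteq> {1..N} \<and> card (NN' k) = S else NN' k = NN' (k - 1)"
    "\<And>k. g' k = avg_grad f (NN' k) (x' k)"
    "\<And>k. \<gamma>' k = (if m dvd k then \<gamma>til / max (real k) 1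
             else min \<gamma>max (max \<gamma>min (bb_coeff (x' k - x' (k - 1)) (g' k - g' (k - 1))))
                    / real k powr (1 + \<delta>))"
    "\<And>k. d' k = - (\<gamma>' k *\<^sub>R g' k)"
    "\<And>k. if m dvd k then \<alpha>' k = 1
       else lsp \<eta> (t k) (\<lambda>a. avg f (NN' k) (x' k + a *\<^sub>R d' k)) (g' k \<bullet> d' k) 1 (\<alpha>' k)"
    "\<And>k. x' (Suc k) = x' k + \<alpha>' k *\<^sub>R d' k"
      by (rule slises_runE) blast
    have x: "x i = x' i" "x (i - 1) = x' (i - 1)"
      using less Suc by auto
    have NN: "NN i = NN' i" "NN (i - 1) = NN' (i - 1)"
      using less.prems Suc by auto
    have g: "g i = g' i" "g (i - 1) = g' (i - 1)"
      by (simp_all only: R(2) R'(2) x NN)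
    have \<gamma>: "\<gamma> i = \<gamma>' i" by (simp only: R(3)[of i] R'(3)[of i] x g)
    have d: "d i = d' i" by (simp only: R(4) R'(4) g \<gamma>)
    have "\<alpha> i = \<alpha>' i"
      using R(5)[of i] R'(5)[of i] lsp_deterministic by (auto simp: x NN g d split: if_splits)
    then show ?thesis unfolding Suc R(6) R'(6) by (simp only: x d)
  qed
qed

text \<open>Brings a cycle into the form required by \<open>block_descent\<close>, with \<open>\<beta> i = \<alpha>\<^sub>k \<gamma>\<^sub>k\<close> for
  \<open>k = j * m + i\<close>. Since \<open>\<alpha>\<^sub>k\<close> lies in \<open>(0,1]\<close>, bounds on \<open>\<gamma>\<^sub>k\<close> carry over. The bound
  on the later steps is stated at the cycle start, so that it does not depend on \<open>i\<close>.\<close>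

lemma slises_run_block:
  assumes run: "slises_run f N S m \<eta> \<gamma>min \<gamma>max \<delta> \<gamma>til t x0 NN x"
    and \<gamma>: "0 < \<gamma>min" "0 \<le> \<gamma>max" "0 \<le> \<gamma>til" and \<delta>: "0 \<le> \<delta>"
  obtains \<beta> where
    "\<And>i. i < m \<Longrightarrow> x (j * m + Suc i) = x (j * m + i) - \<beta> i *\<^sub>R avg_grad f (NN (j * m)) (x (j * m + i))"
    "\<And>i. i < m \<Longrightarrow> 0 \<le> \<beta> i" "\<And>i. i < m \<Longrightarrow> \<beta> i \<le> max \<gamma>max \<gamma>til"
    "\<beta> 0 = \<gamma>til / max (real (j * m)) 1"
    "\<And>i. 0 < i \<Longrightarrow> i < m \<Longrightarrow> \<beta> i \<le> \<gamma>max / max (real (j * m)) 1 powr (1 + \<delta>)"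
proof -
  from run obtain g \<gamma> d \<alpha> where R:
    "\<And>k. if m dvd k then NN k \<subseteq> {1..N} \<and> card (NN k) = S else NN k = NN (k - 1)"
    "\<And>k. g k = avg_grad f (NN k) (x k)"
    "\<And>k. \<gamma> k = (if m dvd k then \<gamma>til / max (real k) 1
             else min \<gamma>max (max \<gamma>min (bb_coeff (x k - x (k - 1)) (g k - g (k - 1))))
                    / real k powr (1 + \<delta>))"
    "\<And>k. d k = - (\<gamma> k *\<^sub>R g k)"
    "\<And>k. if m dvd k then \<alpha> k = 1
       else lsp \<eta> (t k) (\<lambda>a. avg f (NN k) (x k + a *\<^sub>R d k)) (g k \<bullet> d k) 1 (\<alpha> k)"
    "\<And>k. x (Suc k) = x k + \<alpha> k *\<^sub>R d k"
    by (rule slises_runE) blast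
  have ndvd: "\<not> m dvd j * m + i" if "0 < i" "i < m" for i
    using that by (simp add: dvd_eq_mod_eq_0)
  have NN: "NN (j * m + i) = NN (j * m)" if "i < m" for i
    using that
  proof (induction i)
    case (Suc i)
    then show ?case using R(1)[of "j * m + Suc i"] ndvd[of "Suc i"] by simp
  qed simp
  have \<alpha>: "0 < \<alpha> k" "\<alpha> k \<le> 1" for k
    using R(5)[of k] lsp_sound(1,2)[of \<eta> "t k" _ _ 1 "\<alpha> k"] by (auto split: if_splits)
  have first: "\<alpha> (j * m) * \<gamma> (j * m) = \<gamma>til / max (real (j * m)) 1"
    using R(5)[of "j * m"] R(3)[of "j * m"] by simp
  have later: "0 \<le> \<gamma> (j * m + i) \<and> \<gamma> (j * m + i) \<le> \<gamma>max / max (real (j * m)) 1 powr (1 + \<delta>)"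
    if "0 < i" "i < m" for i
  proof -
    let ?c = "min \<gamma>max (max \<gamma>min (bb_coeff (x (j*m+i) - x (j*m+i - 1)) (g (j*m+i) - g (j*m+i - 1))))"
    have c: "0 \<le> ?c" "?c \<le> \<gamma>max" using \<gamma> by auto
    have "max (real (j * m)) 1 \<le> real (j * m + i)"
      using \<open>0 < i\<close> by (intro max.boundedI) linarith+
    then have pw: "max (real (j * m)) 1 powr (1 + \<delta>) \<le> real (j * m + i) powr (1 + \<delta>)"
      using \<delta> by (intro powr_mono2) auto
    have "?c / real (j * m + i) powr (1 + \<delta>) \<le> \<gamma>max / max (real (j * m)) 1 powr (1 + \<delta>)"
      using c \<gamma>(2) pw by (intro frac_le) auto
    then show ?thesis using R(3)[of "j * m + i"] ndvd[OF that] c by auto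
  qed
  have cmax: "\<gamma>max / max (real (j * m)) 1 powr (1 + \<delta>) \<le> \<gamma>max"
  proof -
    have "1 powr (1 + \<delta>) \<le> max (real (j * m)) 1 powr (1 + \<delta>)"
      using \<delta> by (intro powr_mono2) auto
    then show ?thesis using \<gamma>(2) by (simp add: divide_le_eq mult_le_cancel_left1)
  qed
  have tmax: "\<gamma>til / max (real (j * m)) 1 \<le> \<gamma>til" "0 \<le> \<gamma>til / max (real (j * m)) 1"
    using \<gamma>(3) by (auto simp: divide_le_eq mult_le_cancel_left1)
  define \<beta> where "\<beta> i = \<alpha> (j * m + i) * \<gamma> (j * m + i)" for i
  have b0: "\<beta> 0 = \<gamma>til / max (real (j * m)) 1" using first by (simp add: \<beta>_def)
  have b: "0 \<le> \<beta> i" "\<beta> i \<le> \<gamma>max / max (real (j * m)) 1 powr (1 + \<delta>)" if "0 < i" "i < m" for i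
  proof -
    have "\<beta> i \<le> \<gamma> (j * m + i)"
      unfolding \<beta>_def using later[OF that] \<alpha>[of "j * m + i"] by (intro mult_left_le_one_le) simp_all
    then show "\<beta> i \<le> \<gamma>max / max (real (j * m)) 1 powr (1 + \<delta>)" using later[OF that] by linarith
    show "0 \<le> \<beta> i"
      unfolding \<beta>_def using later[OF that] \<alpha>(1)[of "j * m + i"] by (intro mult_nonneg_nonneg) simp_all
  qed
  show thesis
  proof (rule that[of \<beta>])
    show "x (j * m + Suc i) = x (j * m + i) - \<beta> i *\<^sub>R avg_grad f (NN (j * m)) (x (j * m + i))"
      if "i < m" for i
      using R(6)[of "j * m + i"] R(4)[of "j * m + i"] R(2)[of "j * m + i"] NN[OF that]
      by (simp add: \<beta>_def)
    fix i assume i: "i < m"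
    show "0 \<le> \<beta> i" using b(1)[of i] i b0 tmax by (cases "i = 0") auto
    show "\<beta> i \<le> max \<gamma>max \<gamma>til" using b(2)[of i] i b0 tmax cmax by (cases "i = 0") auto
  qed (use b b0 in auto)
qed

section \<open>Quantities determined by finitely many subsamples\<close>

text \<open>Each choice has finitely many outcomes, so a real function of the first \<open>k\<close> choices is automatically
  measurable with respect to the history, bounded and integrable. This settles the existence of all
  the expectations below.\<close>

locale finite_sampling = prob_space M
  for M :: "'w measure" +
  fixes NN :: "nat \<Rightarrow> 'w \<Rightarrow> nat set" and Q :: "nat set set"
  assumes finite_Q: "finite Q"
    and NN_measurable: "\<And>k. NN k \<in> measurable M (count_space Q)"
begin

definition history_dependent :: "nat \<Rightarrow> ('w \<Rightarrow> 'b) \<Rightarrow> bool" where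
  "history_dependent k h \<longleftrightarrow>
     (\<forall>\<omega>\<in>space M. \<forall>\<omega>'\<in>space M. (\<forall>j<k. NN j \<omega> = NN j \<omega>') \<longrightarrow> h \<omega> = h \<omega>')"

lemma history_dependent_mono:
  "history_dependent k h \<Longrightarrow> k \<le> l \<Longrightarrow> history_dependent l h"
  unfolding history_dependent_def by (meson order_less_le_trans)

lemma history_dependent_comb:
  assumes "history_dependent k h" "history_dependent k h'"
  shows "history_dependent k (\<lambda>\<omega>. c (h \<omega>) (h' \<omega>))"
  unfolding history_dependent_def
proof (intro ballI impI)
  fix \<omega> \<omega>' assume "\<omega> \<in> space M" "\<omega>' \<in> space M" "\<forall>j<k. NN j \<omega> = NN j \<omega>'"
  then have "h \<omega> = h \<omega>'" "h' \<omega> = h' \<omega>'"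
    using assms unfolding history_dependent_def by blast+
  then show "c (h \<omega>) (h' \<omega>) = c (h \<omega>') (h' \<omega>')" by (rule arg_cong2)
qed

lemma space_hist: "space (hist M NN k) = space M"
  by (simp add: hist_def space_measure_of_conv)

lemma sets_hist: "sets (hist M NN k) = sigma_sets (space M) {NN j -` B \<inter> space M | j B. j < k}"
  unfolding hist_def by (rule sets_measure_of) auto

lemma subalgebra_hist: "subalgebra M (hist M NN k)"
proof -
  have "NN j -` B \<inter> space M \<in> sets M" for j B
  proof -
    have "NN j -` B \<inter> space M = NN j -` (B \<inter> Q) \<inter> space M"
      using measurable_space[OF NN_measurable[of j]] by auto
    then show ?thesis using measurable_sets[OF NN_measurable, of "B \<inter> Q" j] by simp
  qed
  then have "{NN j -` B \<inter> space M | j B. j < k} \<subseteq> sets M" by blast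
  then have "sigma_sets (space M) {NN j -` B \<inter> space M | j B. j < k} \<subseteq> sets M"
    by (rule sets.sigma_sets_subset)
  then show ?thesis unfolding subalgebra_def by (simp only: sets_hist space_hist simp_thms)
qed

sublocale hist: finite_measure_subalgebra M "hist M NN k" for k
  by unfold_locales (rule subalgebra_hist)

lemma measurable_history:
  "(\<lambda>\<omega>. \<lambda>j\<in>{..<k}. NN j \<omega>) \<in> measurable (hist M NN k) (count_space (PiE {..<k} (\<lambda>_. Q)))"
proof -
  have fin: "finite (PiE {..<k} (\<lambda>_. Q))" using finite_Q by (simp add: finite_PiE)
  have "(\<lambda>\<omega>. \<lambda>j\<in>{..<k}. NN j \<omega>) -` {a} \<inter> space (hist M NN k) \<in> sets (hist M NN k)"
    if a: "a \<in> PiE {..<k} (\<lambda>_. Q)" for a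
  proof -
  have "(\<lambda>j\<in>{..<k}. NN j \<omega>) = a \<longleftrightarrow> (\<forall>j\<in>{..<k}. NN j \<omega> = a j)" for \<omega>
  proof
    assume "\<forall>j\<in>{..<k}. NN j \<omega> = a j"
    with a show "(\<lambda>j\<in>{..<k}. NN j \<omega>) = a"
      by (intro extensionalityI[of _ "{..<k}"]) (simp_all add: PiE_def)
  qed auto
  then have "(\<lambda>\<omega>. \<lambda>j\<in>{..<k}. NN j \<omega>) -` {a} \<inter> space (hist M NN k)
      = {\<omega> \<in> space (hist M NN k). \<forall>j\<in>{..<k}. NN j \<omega> = a j}"
    by (simp only: vimage_def Int_def mem_Collect_eq singleton_iff conj_commute)
  moreover have "{\<omega> \<in> space (hist M NN k). NN j \<omega> = a j} \<in> sets (hist M NN k)"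
    if "j < k" for j
  proof -
    have "{\<omega> \<in> space (hist M NN k). NN j \<omega> = a j} = NN j -` {a j} \<inter> space M"
      unfolding space_hist by blast
    moreover have "NN j -` {a j} \<inter> space M \<in> sets (hist M NN k)"
      unfolding sets_hist using that by (intro sigma_sets.Basic) blast
    ultimately show ?thesis by (simp only:)
  qed
  then have "{\<omega> \<in> space (hist M NN k). \<forall>j\<in>{..<k}. NN j \<omega> = a j} \<in> sets (hist M NN k)"
    by (intro sets.sets_Collect_finite_All finite_lessThan) (simp only: lessThan_iff)
  ultimately show "(\<lambda>\<omega>. \<lambda>j\<in>{..<k}. NN j \<omega>) -` {a} \<inter> space (hist M NN k) \<in> sets (hist M NN k)"
    by (simp only:)
  qed
  moreover have "(\<lambda>\<omega>. \<lambda>j\<in>{..<k}. NN j \<omega>) \<in> space (hist M NN k) \<rightarrow> PiE {..<k} (\<lambda>_. Q)"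
    using measurable_space[OF NN_measurable] by (auto simp: space_hist)
  ultimately show ?thesis by (simp only: measurable_count_space_eq2[OF fin]) blast
qed

text \<open>A function that depends on \<open>\<omega>\<close> only through the first \<open>k\<close> choices factors through the tuple of
  these choices, a map into a finite discrete space.\<close>

lemma history_dependent_factor:
  assumes "history_dependent k h"
  obtains H where "\<And>\<omega>. \<omega> \<in> space M \<Longrightarrow> h \<omega> = H (\<lambda>j\<in>{..<k}. NN j \<omega>)"
proof
  let ?R = "\<lambda>\<omega>. \<lambda>j\<in>{..<k}. NN j \<omega>"
  fix \<omega> assume \<omega>: "\<omega> \<in> space M"
  define \<omega>' where "\<omega>' = inv_into (space M) ?R (?R \<omega>)"
  have "?R \<omega>' = ?R \<omega>" unfolding \<omega>'_def using \<omega> by (intro f_inv_into_f imageI)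
  then have "?R \<omega>' j = ?R \<omega> j" for j by (rule fun_cong)
  then have "NN j \<omega> = NN j \<omega>'" if "j < k" for j using that by (metis lessThan_iff restrict_apply')
  moreover have "\<omega>' \<in> space M" unfolding \<omega>'_def using \<omega> by (intro inv_into_into imageI)
  ultimately have "h \<omega> = h \<omega>'" using assms \<omega> unfolding history_dependent_def by blast
  then show "h \<omega> = (h \<circ> inv_into (space M) ?R) (?R \<omega>)" by (simp only: \<omega>'_def comp_def)
qed

lemma borel_measurable_history_dependent:
  fixes h :: "'w \<Rightarrow> 'b::topological_space"
  assumes "history_dependent k h"
  shows "h \<in> borel_measurable (hist M NN k)"
proof -
  from history_dependent_factor[OF assms] obtain H
    where H: "\<And>\<omega>. \<omega> \<in> space M \<Longrightarrow> h \<omega> = H (\<lambda>j\<in>{..<k}. NN j \<omega>)" by blast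
  have "(\<lambda>\<omega>. H (\<lambda>j\<in>{..<k}. NN j \<omega>)) \<in> borel_measurable (hist M NN k)"
    by (rule measurable_compose[OF measurable_history]) simp
  then show ?thesis using H by (subst measurable_cong[where g = "\<lambda>\<omega>. H (\<lambda>j\<in>{..<k}. NN j \<omega>)"])
      (simp_all add: space_hist)
qed

lemma integrable_history_dependent:
  fixes h :: "'w \<Rightarrow> real"
  assumes "history_dependent k h"
  shows "integrable M h"
proof -
  from history_dependent_factor[OF assms] obtain H
    where H: "\<And>\<omega>. \<omega> \<in> space M \<Longrightarrow> h \<omega> = H (\<lambda>j\<in>{..<k}. NN j \<omega>)" by blast
  have "h ` space M \<subseteq> H ` PiE {..<k} (\<lambda>_. Q)"
    using H measurable_space[OF measurable_history[of k]] by (auto simp: space_hist)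
  moreover have "finite (PiE {..<k} (\<lambda>_. Q))" using finite_Q by (simp add: finite_PiE)
  ultimately have "finite (h ` space M)" by (metis finite_imageI finite_subset)
  then have "bounded (h ` space M)" by (rule finite_imp_bounded)
  then obtain B where "\<And>\<omega>. \<omega> \<in> space M \<Longrightarrow> norm (h \<omega>) \<le> B" by (auto simp: bounded_iff)
  moreover have "h \<in> borel_measurable M"
    using measurable_from_subalg[OF subalgebra_hist borel_measurable_history_dependent[OF assms]] .
  ultimately show ?thesis by (intro integrable_const_bound[where B = B]) auto
qed

text \<open>The tower property for a fresh choice: given the past, each outcome \<open>A\<close> has the same conditional
  probability \<open>p\<close>, which can be pulled out of the expectation because \<open>\<phi> A\<close> is known from the past.\<close>

lemma expectation_uniform_choice:
  fixes \<phi> :: "nat set \<Rightarrow> 'w \<Rightarrow> real"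
  assumes P: "finite P" "\<And>\<omega>. \<omega> \<in> space M \<Longrightarrow> NN k \<omega> \<in> P"
    and unif: "\<And>A. A \<in> P \<Longrightarrow>
      AE \<omega> in M. real_cond_exp M (hist M NN k) (indicator {\<omega> \<in> space M. NN k \<omega> = A}) \<omega> = p"
    and \<phi>: "\<And>A. A \<in> P \<Longrightarrow> history_dependent k (\<phi> A)"
  shows "expectation (\<lambda>\<omega>. \<phi> (NN k \<omega>) \<omega>) = p * expectation (\<lambda>\<omega>. \<Sum>A\<in>P. \<phi> A \<omega>)"
proof -
  let ?ev = "\<lambda>A. {\<omega> \<in> space M. NN k \<omega> = A}"
  have ev: "history_dependent (Suc k) (indicator (?ev A) :: 'w \<Rightarrow> real)" for A
    unfolding history_dependent_def by (auto simp: indicator_def)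
  have prod: "history_dependent (Suc k) (\<lambda>\<omega>. \<phi> A \<omega> * indicator (?ev A) \<omega>)" if "A \<in> P" for A
    using history_dependent_mono[OF \<phi>[OF that], of "Suc k"] ev[of A] by (auto intro: history_dependent_comb)
  have part: "expectation (\<lambda>\<omega>. \<phi> A \<omega> * indicator (?ev A) \<omega>) = p * expectation (\<phi> A)"
    if A: "A \<in> P" for A
  proof -
    have m: "\<phi> A \<in> borel_measurable (hist M NN k)"
      by (rule borel_measurable_history_dependent[OF \<phi>[OF A]])
    have i: "(indicator (?ev A) :: 'w \<Rightarrow> real) \<in> borel_measurable M"
      using integrable_history_dependent[OF ev[of A]] by (rule borel_measurable_integrable)
    have "expectation (\<lambda>\<omega>. \<phi> A \<omega> * indicator (?ev A) \<omega>)
        = expectation (\<lambda>\<omega>. \<phi> A \<omega> * real_cond_exp M (hist M NN k) (indicator (?ev A)) \<omega>)"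
      by (rule hist.real_cond_exp_intg(2)[OF integrable_history_dependent[OF prod[OF A]] m i, symmetric])
    also have "\<dots> = expectation (\<lambda>\<omega>. \<phi> A \<omega> * p)"
    proof (rule integral_cong_AE)
      note [measurable] = measurable_from_subalg[OF subalgebra_hist m]
      show "(\<lambda>\<omega>. \<phi> A \<omega> * p) \<in> borel_measurable M" by measurable
      show "(\<lambda>\<omega>. \<phi> A \<omega> * real_cond_exp M (hist M NN k) (indicator (?ev A)) \<omega>) \<in> borel_measurable M"
        by measurable
      show "AE \<omega> in M. \<phi> A \<omega> * real_cond_exp M (hist M NN k) (indicator (?ev A)) \<omega> = \<phi> A \<omega> * p"
        using unif[OF A] by eventually_elim simp
    qed
    finally show ?thesis by simp
  qed
  have "expectation (\<lambda>\<omega>. \<phi> (NN k \<omega>) \<omega>)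
      = expectation (\<lambda>\<omega>. \<Sum>A\<in>P. \<phi> A \<omega> * indicator (?ev A) \<omega>)"
  proof (rule Bochner_Integration.integral_cong[OF refl])
    fix \<omega> assume \<omega>: "\<omega> \<in> space M"
    have "(\<Sum>A\<in>P. \<phi> A \<omega> * indicator (?ev A) \<omega>) = (\<Sum>A\<in>P. if NN k \<omega> = A then \<phi> A \<omega> else 0)"
      using \<omega> by (intro sum.cong) auto
    also have "\<dots> = \<phi> (NN k \<omega>) \<omega>" using P \<omega> by (simp add: sum.delta)
    finally show "\<phi> (NN k \<omega>) \<omega> = (\<Sum>A\<in>P. \<phi> A \<omega> * indicator (?ev A) \<omega>)" by simp
  qed
  also have "\<dots> = (\<Sum>A\<in>P. p * expectation (\<phi> A))"
    using part integrable_history_dependent[OF prod] by (subst Bochner_Integration.integral_sum) auto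
  also have "\<dots> = p * expectation (\<lambda>\<omega>. \<Sum>A\<in>P. \<phi> A \<omega>)"
    using integrable_history_dependent[OF \<phi>]
    by (subst Bochner_Integration.integral_sum) (auto simp: sum_distrib_left)
  finally show ?thesis .
qed

end

section \<open>Almost sure convergence\<close>

theorem theorem3p3:
  fixes M :: "'w measure"
    and f :: "nat \<Rightarrow> real^'n \<Rightarrow> real"
    and N S m :: nat
    and \<eta> \<gamma>min \<gamma>max \<delta> \<gamma>til tbar L G :: real
    and t :: "nat \<Rightarrow> real"
    and x0 :: "real^'n"
    and NN :: "nat \<Rightarrow> 'w \<Rightarrow> nat set"
    and x :: "nat \<Rightarrow> 'w \<Rightarrow> real^'n"
  assumes prob: "prob_space M"
    and eta: "0 < \<eta>" "\<eta> < 1"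
    and S: "S \<in> {1..N}"
    and m: "m > 1"
    and gamma: "0 < \<gamma>min" "\<gamma>min \<le> 1" "1 \<le> \<gamma>max"
    and delta: "\<delta> > 0"
    and gamma_til: "\<gamma>til > 0"
    and t: "\<And>k. 0 \<le> t k" "summable t" "(\<Sum>k. t k) \<le> tbar"
    and A1_bdd: "\<And>i. i \<in> {1..N} \<Longrightarrow> bdd_below (range (f i))"
    and A1_C2: "\<And>i. i \<in> {1..N} \<Longrightarrow> twice_continuously_differentiable (f i)"
    and A1_lip: "\<And>i. i \<in> {1..N} \<Longrightarrow> L-lipschitz_on UNIV (grad (f i))"
    and NN_rv: "\<And>k. NN k \<in> measurable M (count_space (Pow {1..N}))"
    and run: "\<And>\<omega>. \<omega> \<in> space M \<Longrightarrow>
      slises_run f N S m \<eta> \<gamma>min \<gamma>max \<delta> \<gamma>til t x0 (\<lambda>k. NN k \<omega>) (\<lambda>k. x k \<omega>)"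
    and unif: "uniform_sampling M N S m NN"
    and A2: "G > 0"
      "\<And>k. m dvd k \<Longrightarrow>
        AE \<omega> in M. real_cond_exp M (hist M NN k)
          (\<lambda>\<omega>. (norm (avg_grad f (NN k \<omega>) (x k \<omega>) - grad (avg f {1..N}) (x k \<omega>)))\<^sup>2) \<omega> \<le> G"
  shows "AE \<omega> in M. liminf (\<lambda>k. ereal (norm (grad (avg f {1..N}) (x k \<omega>)))) = 0"
proof -
  interpret prob_space M by (rule prob)
  interpret finite_sampling M NN "Pow {1..N}"
    by unfold_locales (use NN_rv in simp_all)
  define F where "F = avg f {1..N}"
  define q where "q = avg_grad f {1..N}"
  have N: "0 < N" "S \<le> N" "0 < S" using S by auto
  have m0: "0 < m" using m by simp
  have diff: "f i differentiable (at y)" if "i \<in> {1..N}" for i y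
    using A1_C2[OF that] by (simp add: twice_continuously_differentiable_def)
  have der: "GDERIV F y :> q y" for y
    unfolding F_def q_def using diff by (rule gderiv_avg)
  have gradF: "grad (avg f {1..N}) = q"
    using grad_eqI[OF der] by (auto simp: F_def)
  have qlip: "L-lipschitz_on UNIV q"
    unfolding q_def using A1_lip N by (intro lipschitz_on_avg_grad) auto
  have hlip: "L-lipschitz_on UNIV (avg_grad f A)" if "A \<subseteq> {1..N}" "card A = S" for A
    using that A1_lip N by (intro lipschitz_on_avg_grad) (auto intro: finite_subset)
  have L: "0 \<le> L" by (rule lipschitz_on_nonneg[OF qlip])
  obtain B where B: "\<And>y. B \<le> F y"
  proof -
    have "\<forall>i\<in>{1..N}. \<exists>b. \<forall>y. b \<le> f i y" using A1_bdd by (auto simp: bdd_below_def)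
    then obtain b where b: "\<And>i y. i \<in> {1..N} \<Longrightarrow> b i \<le> f i y" by metis
    show thesis
    proof (rule that)
      show "(\<Sum>i\<in>{1..N}. b i) / real (card {1..N}) \<le> F y" for y
        unfolding F_def avg_def using b by (intro divide_right_mono sum_mono) auto
    qed
  qed
  have sub: "NN k \<omega> \<subseteq> {1..N} \<and> card (NN k \<omega>) = S" if "\<omega> \<in> space M" for k \<omega>
    by (rule slises_run_subsample[OF run[OF that]])

  have x_hist: "history_dependent k (x k)" for k
    unfolding history_dependent_def using slises_run_deterministic[OF run run] by blast
  have x_fun: "history_dependent k (\<lambda>\<omega>. u (x k \<omega>))" for k and u :: "real^'n \<Rightarrow> real"
    using history_dependent_comb[OF x_hist x_hist, where c = "\<lambda>y _. u y"] .
  have x_NN_fun: "history_dependent (Suc k) (\<lambda>\<omega>. u (NN k \<omega>) (x k \<omega>))"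
    for k and u :: "nat set \<Rightarrow> real^'n \<Rightarrow> real"
  proof (rule history_dependent_comb[where c = u])
    show "history_dependent (Suc k) (NN k)" by (simp add: history_dependent_def)
    show "history_dependent (Suc k) (x k)" by (rule history_dependent_mono[OF x_hist]) simp
  qed
  note int_x = integrable_history_dependent[OF x_fun]
  note int_NN = integrable_history_dependent[OF x_NN_fun]

  \<comment> \<open>\<open>\<Gamma>\<close> bounds every step length, \<open>\<gamma> j\<close> and \<open>c j\<close> those of the first and of the later steps of
    cycle \<open>j\<close>; \<open>C\<close> and \<open>K\<close> are the constants of the one-cycle estimate.\<close>
  define \<Gamma> where "\<Gamma> = max \<gamma>max \<gamma>til"
  define C where "C = (1 + L * \<Gamma>) ^ m"
  define K where "K = C + L * (real m + 1) * \<Gamma> * C\<^sup>2"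
  define \<gamma> where "\<gamma> j = \<gamma>til / max (real (j * m)) 1" for j
  define c where "c j = \<gamma>max / max (real (j * m)) 1 powr (1 + \<delta>)" for j
  define e where "e j = L * (\<gamma> j)\<^sup>2 + real m * c j * K" for j
  define g where "g j \<omega> = avg_grad f (NN (j * m) \<omega>) (x (j * m) \<omega>)" for j \<omega>
  define a where "a j \<omega> = norm (q (x (j * m) \<omega>))" for j \<omega>
  have \<Gamma>: "0 \<le> \<Gamma>" using gamma by (simp add: \<Gamma>_def)
  have C0: "0 \<le> C" using L \<Gamma> by (simp add: C_def)
  have K0: "0 \<le> K" using C0 L \<Gamma> by (simp add: K_def)
  have \<gamma>_pos: "0 < \<gamma> j" for j using gamma_til by (simp add: \<gamma>_def)
  have c0: "0 \<le> c j" for j using gamma by (simp add: c_def)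
  have e0: "0 \<le> e j" for j using L c0 K0 by (simp add: e_def)

  have path: "F (x (Suc j * m) \<omega>) \<le> F (x (j * m) \<omega>) - \<gamma> j * (q (x (j * m) \<omega>) \<bullet> g j \<omega>)
      + e j * ((a j \<omega>)\<^sup>2 + (norm (g j \<omega>))\<^sup>2)" if \<omega>: "\<omega> \<in> space M" for j \<omega>
  proof -
    have nn: "0 \<le> \<gamma>max" "0 \<le> \<gamma>til" "0 \<le> \<delta>" using gamma gamma_til delta by auto
    from slises_run_block[OF run[OF \<omega>] gamma(1) nn, of j] obtain \<beta> where \<beta>:
      "\<And>i. i < m \<Longrightarrow> x (j * m + Suc i) \<omega>
          = x (j * m + i) \<omega> - \<beta> i *\<^sub>R avg_grad f (NN (j * m) \<omega>) (x (j * m + i) \<omega>)"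
      "\<And>i. i < m \<Longrightarrow> 0 \<le> \<beta> i" "\<And>i. i < m \<Longrightarrow> \<beta> i \<le> \<Gamma>"
      "\<beta> 0 = \<gamma> j" "\<And>i. 0 < i \<Longrightarrow> i < m \<Longrightarrow> \<beta> i \<le> c j"
      unfolding \<Gamma>_def \<gamma>_def c_def by metis
    have h: "L-lipschitz_on UNIV (avg_grad f (NN (j * m) \<omega>))"
      using sub[OF \<omega>] hlip by blast
    have "F (x (j * m + m) \<omega>)
        \<le> F (x (j * m + 0) \<omega>) - \<beta> 0 * (q (x (j * m + 0) \<omega>) \<bullet> avg_grad f (NN (j * m) \<omega>) (x (j * m + 0) \<omega>))
          + (L * (\<beta> 0)\<^sup>2 + real m * c j * K) * ((norm (q (x (j * m + 0) \<omega>)))\<^sup>2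
              + (norm (avg_grad f (NN (j * m) \<omega>) (x (j * m + 0) \<omega>)))\<^sup>2)"
      using block_descent[OF der qlip h, where z = "\<lambda>i. x (j * m + i) \<omega>" and \<beta> = \<beta> and m = m
          and \<Gamma> = \<Gamma> and c = "c j" and C = C and K = K]
        \<beta> c0 m0 C_def K_def by blast
    then show ?thesis
      by (simp add: \<beta>(4) e_def a_def g_def add.commute[of m])
  qed

  let ?P = "{A. A \<subseteq> {1..N} \<and> card A = S}"
  \<comment> \<open>the past determines \<open>x (j * m)\<close>, so the inner product may be averaged over the fresh subsample\<close>
  have unbiased: "expectation (\<lambda>\<omega>. q (x (j * m) \<omega>) \<bullet> g j \<omega>) = expectation (\<lambda>\<omega>. (a j \<omega>)\<^sup>2)" for j
  proof -
    have NS: "0 < N choose S" using N by (simp add: zero_less_binomial_iff)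
    have "expectation (\<lambda>\<omega>. q (x (j * m) \<omega>) \<bullet> g j \<omega>)
        = 1 / real (N choose S) * expectation (\<lambda>\<omega>. \<Sum>A\<in>?P. q (x (j * m) \<omega>) \<bullet> avg_grad f A (x (j * m) \<omega>))"
      unfolding g_def
    proof (rule expectation_uniform_choice[where \<phi> = "\<lambda>A \<omega>. q (x (j * m) \<omega>) \<bullet> avg_grad f A (x (j * m) \<omega>)"])
      show "history_dependent (j * m) (\<lambda>\<omega>. q (x (j * m) \<omega>) \<bullet> avg_grad f A (x (j * m) \<omega>))" for A
        by (rule x_fun)
    qed (use sub unif in \<open>auto simp: uniform_sampling_def\<close>)
    also have "(\<lambda>\<omega>. \<Sum>A\<in>?P. q (x (j * m) \<omega>) \<bullet> avg_grad f A (x (j * m) \<omega>))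
        = (\<lambda>\<omega>. real (N choose S) * (a j \<omega>)\<^sup>2)"
      using sum_avg_grad_subsets[of "{1..N}" S f] N
      by (simp add: a_def dot_square_norm q_def flip: inner_sum_right)
    finally show ?thesis using NS by simp
  qed
  have second: "expectation (\<lambda>\<omega>. (norm (g j \<omega>))\<^sup>2) \<le> 2 * expectation (\<lambda>\<omega>. (a j \<omega>)\<^sup>2) + 2 * G" for j
  proof -
    let ?D = "\<lambda>\<omega>. (norm (g j \<omega> - q (x (j * m) \<omega>)))\<^sup>2"
    have intD: "integrable M ?D" unfolding g_def by (rule int_NN)
    have intg: "integrable M (\<lambda>\<omega>. (norm (g j \<omega>))\<^sup>2)" unfolding g_def by (rule int_NN)
    have inta: "integrable M (\<lambda>\<omega>. (a j \<omega>)\<^sup>2)" unfolding a_def by (rule int_x)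
    have "AE \<omega> in M. real_cond_exp M (hist M NN (j * m)) ?D \<omega> \<le> G"
      using A2(2)[of "j * m"] unfolding gradF g_def by simp
    then have "expectation (real_cond_exp M (hist M NN (j * m)) ?D) \<le> G"
      using hist.real_cond_exp_int(1)[OF intD] by (intro integral_le_const)
    then have D: "expectation ?D \<le> G" using hist.real_cond_exp_int(2)[OF intD] by simp
    have "(norm (g j \<omega>))\<^sup>2 \<le> 2 * (a j \<omega>)\<^sup>2 + 2 * ?D \<omega>" for \<omega>
    proof -
      have "norm (g j \<omega>) \<le> a j \<omega> + norm (g j \<omega> - q (x (j * m) \<omega>))"
        unfolding a_def by (metis norm_triangle_sub)
      then have "(norm (g j \<omega>))\<^sup>2 \<le> (a j \<omega> + norm (g j \<omega> - q (x (j * m) \<omega>)))\<^sup>2"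
        by (intro power_mono) auto
      also have "\<dots> \<le> 2 * (a j \<omega>)\<^sup>2 + 2 * ?D \<omega>"
        using sum_squares_bound[of "a j \<omega>" "norm (g j \<omega> - q (x (j * m) \<omega>))"]
        by (simp add: power2_sum)
      finally show ?thesis .
    qed
    then have "expectation (\<lambda>\<omega>. (norm (g j \<omega>))\<^sup>2) \<le> expectation (\<lambda>\<omega>. 2 * (a j \<omega>)\<^sup>2 + 2 * ?D \<omega>)"
      using intg inta intD by (intro integral_mono) auto
    also have "\<dots> = 2 * expectation (\<lambda>\<omega>. (a j \<omega>)\<^sup>2) + 2 * expectation ?D"
      using inta intD by simp
    finally show ?thesis using D by simp
  qed

  define v where "v j = expectation (\<lambda>\<omega>. F (x (j * m) \<omega>))" for j
  define w where "w j = expectation (\<lambda>\<omega>. (a j \<omega>)\<^sup>2)" for j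
  have rec: "v (Suc j) \<le> v j - \<gamma> j * w j + e j * (3 * w j + 2 * G)" for j
  proof -
    have ints: "integrable M (\<lambda>\<omega>. F (x (k * m) \<omega>))" "integrable M (\<lambda>\<omega>. (a k \<omega>)\<^sup>2)"
      "integrable M (\<lambda>\<omega>. q (x (k * m) \<omega>) \<bullet> g k \<omega>)" "integrable M (\<lambda>\<omega>. (norm (g k \<omega>))\<^sup>2)" for k
      unfolding a_def g_def by (rule int_x int_NN)+
    have "v (Suc j) \<le> expectation (\<lambda>\<omega>. F (x (j * m) \<omega>) - \<gamma> j * (q (x (j * m) \<omega>) \<bullet> g j \<omega>)
        + e j * ((a j \<omega>)\<^sup>2 + (norm (g j \<omega>))\<^sup>2))"
      unfolding v_def
    proof (rule integral_mono)
      show "integrable M (\<lambda>\<omega>. F (x (Suc j * m) \<omega>))" by (rule ints)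
    qed (use path ints in auto)
    also have "\<dots> = v j - \<gamma> j * w j + e j * (w j + expectation (\<lambda>\<omega>. (norm (g j \<omega>))\<^sup>2))"
      using ints unbiased[of j] by (simp add: v_def w_def)
    also have "\<dots> \<le> v j - \<gamma> j * w j + e j * (3 * w j + 2 * G)"
      using e0 second[of j] by (intro add_left_mono mult_left_mono) (auto simp: w_def)
    finally show ?thesis .
  qed
  have "summable (\<lambda>j. \<gamma> j * w j)"
  proof (rule summable_of_descent_recursion[where v = v and w = w and e = e and b = "2 * G" and B = B])
    show "B \<le> v j" for j
    proof -
      have "expectation (\<lambda>\<omega>. B) \<le> v j"
        unfolding v_def using B int_x by (intro integral_mono) auto
      then show ?thesis by (simp add: prob_space)
    qed
    have e_eq: "e j = L * \<gamma>til\<^sup>2 * inverse (max (real (j * m)) 1 powr 2)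
        + real m * \<gamma>max * K * inverse (max (real (j * m)) 1 powr (1 + \<delta>))" for j
      by (simp add: e_def \<gamma>_def c_def divide_inverse power_mult_distrib power_inverse)
    show "summable e"
      unfolding e_eq using m0 delta
      by (intro summable_add summable_mult summable_powr_neg_multiples) auto
    \<comment> \<open>dividing by \<open>\<gamma> j\<close>, which is of order \<open>1/j\<close>, lowers both exponents by one and leaves them positive\<close>
    have quot: "e j / \<gamma> j = L * \<gamma>til * inverse (max (real (j * m)) 1 powr 1)
        + real m * \<gamma>max * K / \<gamma>til * inverse (max (real (j * m)) 1 powr \<delta>)" for j
    proof -
      define M where "M = max (real (j * m)) 1"
      have M: "0 < M" by (simp add: M_def)
      show ?thesis
        using M gamma_til unfolding e_def \<gamma>_def c_def M_def[symmetric]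
        by (simp add: field_simps powr_add power2_eq_square)
    qed
    have "(\<lambda>j. L * \<gamma>til * inverse (max (real (j * m)) 1 powr 1)
        + real m * \<gamma>max * K / \<gamma>til * inverse (max (real (j * m)) 1 powr \<delta>))
        \<longlonglongrightarrow> L * \<gamma>til * 0 + real m * \<gamma>max * K / \<gamma>til * 0"
      using m0 delta by (intro tendsto_intros tendsto_powr_neg_multiples) auto
    then show "(\<lambda>j. e j / \<gamma> j) \<longlonglongrightarrow> 0" unfolding quot by simp
  qed (use rec \<gamma>_pos e0 A2(1) in \<open>auto simp: w_def intro: integral_nonneg\<close>)
  moreover have "integrable M (\<lambda>\<omega>. (a j \<omega>)\<^sup>2)" for j unfolding a_def by (rule int_x)
  ultimately have "AE \<omega> in M. summable (\<lambda>j. \<gamma> j * (a j \<omega>)\<^sup>2)"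
    using \<gamma>_pos by (intro AE_summable_of_summable_integrals) (auto simp: w_def less_imp_le)
  then show ?thesis
  proof eventually_elim
    case (elim \<omega>)
    show ?case unfolding gradF
    proof (rule liminf_zero_of_weighted_summable[where \<gamma> = \<gamma> and m = m])
      show "\<not> summable \<gamma>"
        using not_summable_harmonic_multiples[OF m0 gamma_til] by (simp add: \<gamma>_def[abs_def])
      show "summable (\<lambda>j. \<gamma> j * (norm (q (x (j * m) \<omega>)))\<^sup>2)"
        using elim unfolding a_def .
    qed (use m0 \<gamma>_pos in \<open>auto intro: less_imp_le\<close>)
  qed
qed

end
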